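(* Fix $1<q\le\infty$ and let $q'$ be its conjugate exponent. Suppose that the Banach space $X$ contains a weakly null semi-normalized basic sequence $\{x_n\}$ which satisfies a lower $q$-estimate. Then for each $1\le p<q'$, $X$ fails property $(E_p)$; that is, it is not true that every $L_p(X)$-bounded sequence of functions that converges scalarly in $L_p$ (to some $f\in L_0(X)$) has a subsequence that converges scalarly a.e.
   Context: $(\Omega,\Sigma,\mu)$ is the Lebesgue measure space on $[0,1]$. Banach spaces are real. $L_0(X)$ is the space of (classes of a.e. equal) strongly measurable functions $f:\Omega\to X$; $L_p(X)$ are the Bochner–Lebesgue spaces, $L_p=L_p(\mathbb R)$. For $f_n,f\in L_0(X)$, $\{f_n\}$ converges scalarly a.e. (resp. scalarly in $L_p$) to $f$ if for each $x^*\in X^*$, $x^*f_n\to x^*f$ almost everywhere, with exceptional null set possibly depending on $x^*$ (resp. in $L_p$). A sequence is $L_p(X)$-bounded if $\sup_n\|f_n\|_{L_p(X)}<\infty$. A sequence $\{x_n\}$ is semi-normalized if $0<\inf_n\|x_n\|\le\sup_n\|x_n\|<\infty$. A basic sequence $\{x_n\}$ satisfies a lower $q$-estimate if there is a constant $c>0$ such that for every $n$ and all scalars $a_1,\dots,a_n$, $c\,\left\|(\|a_ix_i\|)_{i=1}^n\right\|_{\ell_q}\le\left\|\sum_{i=1}^n a_ix_i\right\|$. The conjugate exponent $q'$ satisfies $1/q+1/q'=1$, with $\infty'=1$. *)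

theory Defs
  imports "HOL-Analysis.Analysis"
begin

section \<open>Vector-valued functions on the unit interval\<close>

abbreviation unit_leb :: "real measure" where
  "unit_leb \<equiv> lebesgue_on {0..1}"

text \<open>
  The space \<open>L\<^sub>0(X)\<close>. Borel measurability would not do, since \<open>X\<close> may be non-separable.
  Classes of a.e. equal functions are represented by their members; everything below is
  invariant under changes on null sets.
\<close>

definition strongly_measurable :: "(real \<Rightarrow> 'a::banach) \<Rightarrow> bool" where
  "strongly_measurable f \<longleftrightarrow>
     (\<exists>s. (\<forall>i::nat. simple_function unit_leb (s i)) \<and>
          (AE \<omega> in unit_leb. (\<lambda>i. s i \<omega>) \<longlonglongrightarrow> f \<omega>))"

text \<open>The Bochner--Lebesgue space \<open>L\<^sub>p(X)\<close> and its norm, for real \<open>p \<ge> 1\<close>.\<close>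

definition Lp_space :: "real \<Rightarrow> (real \<Rightarrow> 'a::banach) set" where
  "Lp_space p =
     {f. strongly_measurable f \<and> integrable unit_leb (\<lambda>\<omega>. norm (f \<omega>) powr p)}"

definition Lp_norm :: "real \<Rightarrow> (real \<Rightarrow> 'a::banach) \<Rightarrow> real" where
  "Lp_norm p f = (\<integral>\<omega>. norm (f \<omega>) powr p \<partial>unit_leb) powr (1 / p)"

definition Lp_bounded :: "real \<Rightarrow> (nat \<Rightarrow> real \<Rightarrow> 'a::banach) \<Rightarrow> bool" where
  "Lp_bounded p f \<longleftrightarrow> (\<forall>n. f n \<in> Lp_space p) \<and> bdd_above (range (\<lambda>n. Lp_norm p (f n)))"

definition tendsto_Lp :: "real \<Rightarrow> (nat \<Rightarrow> real \<Rightarrow> 'a::banach) \<Rightarrow> (real \<Rightarrow> 'a) \<Rightarrow> bool" where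
  "tendsto_Lp p f g \<longleftrightarrow>
     (\<forall>n. f n \<in> Lp_space p) \<and> g \<in> Lp_space p \<and>
     (\<lambda>n. Lp_norm p (\<lambda>\<omega>. f n \<omega> - g \<omega>)) \<longlonglongrightarrow> 0"

definition tendsto_scalarly_ae :: "(nat \<Rightarrow> real \<Rightarrow> 'a::banach) \<Rightarrow> (real \<Rightarrow> 'a) \<Rightarrow> bool" where
  "tendsto_scalarly_ae f g \<longleftrightarrow>
     (\<forall>\<phi> :: 'a \<Rightarrow>\<^sub>L real. AE \<omega> in unit_leb. (\<lambda>n. blinfun_apply \<phi> (f n \<omega>)) \<longlonglongrightarrow> blinfun_apply \<phi> (g \<omega>))"

definition tendsto_scalarly_Lp ::
    "real \<Rightarrow> (nat \<Rightarrow> real \<Rightarrow> 'a::banach) \<Rightarrow> (real \<Rightarrow> 'a) \<Rightarrow> bool" where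
  "tendsto_scalarly_Lp p f g \<longleftrightarrow>
     (\<forall>\<phi> :: 'a \<Rightarrow>\<^sub>L real.
        tendsto_Lp p (\<lambda>n \<omega>. blinfun_apply \<phi> (f n \<omega>)) (\<lambda>\<omega>. blinfun_apply \<phi> (g \<omega>)))"

text \<open>
  Property \<open>(E\<^sub>p)\<close> of the Banach space carried by the type \<open>'a\<close>. The limit of the subsequence
  is an arbitrary \<open>h \<in> L\<^sub>0(X)\<close>; it necessarily agrees with \<open>g\<close> almost everywhere.
\<close>

definition property_E :: "'a::banach itself \<Rightarrow> real \<Rightarrow> bool" where
  "property_E _ p \<longleftrightarrow>
     (\<forall>(f :: nat \<Rightarrow> real \<Rightarrow> 'a) g.
        Lp_bounded p f \<and> strongly_measurable g \<and> tendsto_scalarly_Lp p f g \<longrightarrow>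
        (\<exists>r h. strict_mono (r :: nat \<Rightarrow> nat) \<and> strongly_measurable h \<and>
               tendsto_scalarly_ae (\<lambda>k. f (r k)) h))"


section \<open>Sequences in a Banach space\<close>

definition weakly_null :: "(nat \<Rightarrow> 'a::banach) \<Rightarrow> bool" where
  "weakly_null x \<longleftrightarrow> (\<forall>\<phi> :: 'a \<Rightarrow>\<^sub>L real. (\<lambda>n. blinfun_apply \<phi> (x n)) \<longlonglongrightarrow> 0)"

definition semi_normalized :: "(nat \<Rightarrow> 'a::banach) \<Rightarrow> bool" where
  "semi_normalized x \<longleftrightarrow>
     0 < (INF n. norm (x n)) \<and> bdd_above (range (\<lambda>n. norm (x n)))"

text \<open>A basic sequence is a Schauder basis of its closed linear span.\<close>

definition basic_sequence :: "(nat \<Rightarrow> 'a::banach) \<Rightarrow> bool" where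
  "basic_sequence x \<longleftrightarrow>
     (\<forall>y \<in> closure (span (range x)). \<exists>!a :: nat \<Rightarrow> real. (\<lambda>n. a n *\<^sub>R x n) sums y)"

text \<open>The \<open>\<ell>\<^sub>q\<close>-norm of \<open>(b\<^sub>0, \<dots>, b\<^bsub>n-1\<^esub>)\<close>, for \<open>1 \<le> q \<le> \<infinity>\<close> and \<open>n \<ge> 1\<close>.\<close>

definition lq_norm :: "ereal \<Rightarrow> nat \<Rightarrow> (nat \<Rightarrow> real) \<Rightarrow> real" where
  "lq_norm q n b =
     (if q = \<infinity> then Max ((\<lambda>i. \<bar>b i\<bar>) ` {..<n})
      else (\<Sum>i<n. \<bar>b i\<bar> powr real_of_ereal q) powr (1 / real_of_ereal q))"

definition lower_estimate :: "ereal \<Rightarrow> (nat \<Rightarrow> 'a::banach) \<Rightarrow> bool" where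
  "lower_estimate q x \<longleftrightarrow>
     (\<exists>c>0. \<forall>n\<ge>1. \<forall>a :: nat \<Rightarrow> real.
        c * lq_norm q n (\<lambda>i. norm (a i *\<^sub>R x i)) \<le> norm (\<Sum>i<n. a i *\<^sub>R x i))"

end

theory Submission
  imports Defs
begin

text \<open>
  The counterexample is \<open>f\<^sub>n = g\<^sub>n x\<^sub>n\<close>, where the \<open>g\<^sub>n\<close> are independent and have (up to truncation) the same
  distribution with tail \<open>\<mu>{g\<^sub>n \<ge> t} \<approx> t\<^sup>-\<^sup>s\<close>, for some \<open>p < s < q'\<close>. They are bounded in \<open>L\<^sub>p\<close> because
  \<open>p < s\<close>, so that \<open>f\<^sub>n \<rightarrow> 0\<close> scalarly in \<open>L\<^sub>p\<close> by weak nullity. Given a subsequence \<open>\<rho>\<close>, put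
  \<open>b\<^bsub>\<rho>(k)\<^esub> \<approx> k\<^bsup>-1/s\<^esup>\<close> and \<open>b\<^sub>n = 0\<close> elsewhere. As \<open>s < q'\<close>, this lies in \<open>\<ell>\<^sub>q\<^sub>'\<close>; by the lower estimate and
  Hahn--Banach some \<open>\<phi>\<close> has \<open>\<phi>(x\<^sub>n) = b\<^sub>n\<close> for all \<open>n\<close>. The independent events \<open>\<phi>(f\<^bsub>\<rho>(k)\<^esub>) \<ge> 1\<close> have
  measures of order \<open>1/k\<close>, so almost every point lies in infinitely many of them. The case \<open>q = \<infinity>\<close> is
  void, since then \<open>q' = 1\<close>.
\<close>

section \<open>The Hahn--Banach theorem\<close>

text \<open>Homogeneity is asked only as an inequality, which is easier to pass to infima; rescaling
  by \<open>1/t\<close> recovers equality for \<open>t > 0\<close>, and \<open>t = 0\<close>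
  together with subadditivity forces \<open>f 0 = 0\<close>.\<close>

definition sublinear :: "('a::real_vector \<Rightarrow> real) \<Rightarrow> bool" where
  "sublinear f \<longleftrightarrow> (\<forall>x y. f (x + y) \<le> f x + f y) \<and> (\<forall>t\<ge>0. \<forall>x. f (t *\<^sub>R x) \<le> t * f x)"

lemma sublinear_add: "sublinear f \<Longrightarrow> f (x + y) \<le> f x + f y"
  by (simp add: sublinear_def)

lemma sublinear_scaleR:
  assumes "sublinear f" "t \<ge> 0"
  shows "f (t *\<^sub>R x) = t * f x"
proof (cases "t = 0")
  case True
  have "f 0 \<le> f 0 + f 0"
    using sublinear_add[OF assms(1), of 0 0] by simp
  moreover have "f (0 *\<^sub>R x) \<le> 0 * f x"
    using assms(1) unfolding sublinear_def by blast
  ultimately show ?thesis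
    using True by simp
next
  case False
  then have "t > 0"
    using assms by simp
  have "f ((1/t) *\<^sub>R t *\<^sub>R x) \<le> (1/t) * f (t *\<^sub>R x)"
    using assms(1) \<open>t > 0\<close> unfolding sublinear_def by (meson divide_nonneg_pos less_imp_le zero_le_one)
  then have "t * f x \<le> f (t *\<^sub>R x)"
    using \<open>t > 0\<close> by (simp add: field_simps)
  then show ?thesis
    using assms unfolding sublinear_def by (simp add: order_antisym)
qed

lemma sublinear_minus:
  assumes "sublinear f"
  shows "- f (- x) \<le> f x"
  using sublinear_add[OF assms, of x "- x"] sublinear_scaleR[OF assms, of 0 x] by simp

text \<open>Serves the three infima below: over shifts in one direction, over a chain, and over a
  graph. The closure conditions give each inequality for single members; it then passes to the
  infimum one variable at a time.\<close>

lemma sublinear_INF: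
  fixes F :: "'i \<Rightarrow> 'a::real_vector \<Rightarrow> real"
  assumes "I \<noteq> {}"
    and bdd: "\<And>x. bdd_below ((\<lambda>i. F i x) ` I)"
    and add: "\<And>i j x y. i \<in> I \<Longrightarrow> j \<in> I \<Longrightarrow> \<exists>k\<in>I. F k (x + y) \<le> F i x + F j y"
    and scale: "\<And>i t x. i \<in> I \<Longrightarrow> t \<ge> 0 \<Longrightarrow> \<exists>k\<in>I. F k (t *\<^sub>R x) \<le> t * F i x"
  shows "sublinear (\<lambda>x. INF i\<in>I. F i x)"
  unfolding sublinear_def
proof (intro conjI allI impI)
  fix x y
  have sum: "(INF i\<in>I. F i (x + y)) \<le> F i x + F j y" if "i \<in> I" "j \<in> I" for i j
    using add[OF that, of x y] cINF_lower[OF bdd] by (meson order_trans)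
  have "(INF i\<in>I. F i (x + y)) - F j y \<le> (INF i\<in>I. F i x)" if "j \<in> I" for j
    using sum[OF _ that] by (intro cINF_greatest \<open>I \<noteq> {}\<close>) (simp add: diff_le_eq)
  then have "(INF i\<in>I. F i (x + y)) - (INF i\<in>I. F i x) \<le> (INF j\<in>I. F j y)"
    by (intro cINF_greatest \<open>I \<noteq> {}\<close>) (simp add: algebra_simps)
  then show "(INF i\<in>I. F i (x + y)) \<le> (INF i\<in>I. F i x) + (INF i\<in>I. F i y)"
    by simp
next
  fix t :: real and x
  assume "t \<ge> 0"
  have le: "(INF i\<in>I. F i (t *\<^sub>R x)) \<le> t * F i x" if "i \<in> I" for i
    using scale[OF that \<open>t \<ge> 0\<close>, of x] cINF_lower[OF bdd] by (meson order_trans)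
  show "(INF i\<in>I. F i (t *\<^sub>R x)) \<le> t * (INF i\<in>I. F i x)"
  proof (cases "t = 0")
    case True
    then show ?thesis
      using le \<open>I \<noteq> {}\<close> by fastforce
  next
    case False
    then have "(INF i\<in>I. F i (t *\<^sub>R x)) / t \<le> (INF i\<in>I. F i x)"
      using le \<open>t \<ge> 0\<close> by (intro cINF_greatest \<open>I \<noteq> {}\<close>) (simp add: field_simps)
    then show ?thesis
      using False \<open>t \<ge> 0\<close> by (simp add: field_simps)
  qed
qed

lemma minimal_sublinear_linear:
  assumes m: "sublinear m"
    and min: "\<And>f. sublinear f \<Longrightarrow> (\<And>x. f x \<le> m x) \<Longrightarrow> f = m"
  shows "linear m"
proof -
  have super: "m y + m x \<le> m (y + x)" for x y
  proof -
    \<comment> \<open>\<open>n\<close> is sublinear and lies below \<open>m\<close>, and it equals \<open>m\<close> only if \<open>m\<close> is superadditive in direction \<open>x\<close>.\<close>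
    define n where "n y = (INF t\<in>{0..}. m (y + t *\<^sub>R x) - t * m x)" for y
    \<comment> \<open>Lower bound: \<open>t * m x = m (t *\<^sub>R x)\<close> is at most
      \<open>m (y + t *\<^sub>R x) + m (- y)\<close>.\<close>
    have bdd: "bdd_below ((\<lambda>t. m (y + t *\<^sub>R x) - t * m x) ` {0..})" for y
    proof (rule bdd_belowI2)
      fix t :: real assume "t \<in> {0..}"
      then show "- m (- y) \<le> m (y + t *\<^sub>R x) - t * m x"
        using sublinear_add[OF m, of "y + t *\<^sub>R x" "- y"] sublinear_scaleR[OF m, of t x] by simp
    qed
    have "sublinear n"
      unfolding n_def
    proof (rule sublinear_INF[OF _ bdd])
      fix t t' :: real and y z
      assume "t \<in> {0..}" "t' \<in> {0..}"
      then show "\<exists>k\<in>{0..}. m (y + z + k *\<^sub>R x) - k * m x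
          \<le> m (y + t *\<^sub>R x) - t * m x + (m (z + t' *\<^sub>R x) - t' * m x)"
        using sublinear_add[OF m, of "y + t *\<^sub>R x" "z + t' *\<^sub>R x"]
        by (intro bexI[of _ "t + t'"]) (auto simp: algebra_simps)
    next
      fix t r :: real and y
      assume "t \<in> {0..}" "r \<ge> 0"
      then show "\<exists>k\<in>{0..}. m (r *\<^sub>R y + k *\<^sub>R x) - k * m x \<le> r * (m (y + t *\<^sub>R x) - t * m x)"
        using sublinear_scaleR[OF m, of r "y + t *\<^sub>R x"]
        by (intro bexI[of _ "r * t"]) (auto simp: algebra_simps)
    qed auto
    moreover have "n z \<le> m z" for z
      using cINF_lower[OF bdd, of 0 z] by (simp add: n_def)
    ultimately have "n = m"
      by (rule min)
    \<comment> \<open>The index \<open>t = 1\<close> of the infimum gives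
      \<open>m y \<le> m (y + x) - m x\<close>.\<close>
    then show ?thesis
      using cINF_lower[OF bdd, of 1 y] by (simp add: n_def fun_eq_iff le_diff_eq)
  qed
  have add: "m (x + y) = m x + m y" for x y
    using super[of x y] sublinear_add[OF m, of x y] by simp
  have neg: "m (- x) = - m x" for x
    using add[of x "- x"] sublinear_scaleR[OF m, of 0 x] by simp
  show ?thesis
  proof (rule linearI)
    fix t :: real and x
    show "m (t *\<^sub>R x) = t *\<^sub>R m x"
      using sublinear_scaleR[OF m, of t x] sublinear_scaleR[OF m, of "- t" x] neg[of "t *\<^sub>R x"]
      by (cases "t \<ge> 0") auto
  qed (rule add)
qed

text \<open>Zorn's lemma run downwards: \<open>A\<close> contains \<open>p\<close>, a nonempty chain
  in \<open>A\<close> has its pointwise infimum in \<open>A\<close>, and a minimal element is linear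
  by \<open>minimal_sublinear_linear\<close>.\<close>

lemma ex_linear_le_sublinear:
  fixes p :: "'a::real_vector \<Rightarrow> real"
  assumes p: "sublinear p"
  shows "\<exists>l. linear l \<and> (\<forall>x. l x \<le> p x)"
proof -
  define A where "A = {f. sublinear f \<and> (\<forall>x. f x \<le> p x)}"
  let ?P = "\<lambda>f g :: 'a \<Rightarrow> real. g \<le> f"
  have "\<exists>m\<in>A. \<forall>f\<in>A. f \<le> m \<longrightarrow> f = m"
  proof (rule predicate_Zorn)
    show "partial_order_on A (relation_of ?P A)"
      by (rule partial_order_on_relation_ofI) auto
  next
    fix C assume C: "C \<in> Chains (relation_of ?P A)"
    then have CA: "C \<subseteq> A"
      unfolding Chains_def relation_of_def by auto
    have chain: "f \<le> g \<or> g \<le> f" if "f \<in> C" "g \<in> C" for f g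
      using C that unfolding Chains_def relation_of_def by auto
    show "\<exists>u\<in>A. \<forall>f\<in>C. u \<le> f"
    proof (cases "C = {}")
      case True
      then show ?thesis
        using p by (auto simp: A_def)
    next
      case False
      have bdd: "bdd_below ((\<lambda>f. f x) ` C)" for x
      proof (rule bdd_belowI2)
        fix f assume "f \<in> C"
        then have "sublinear f" "f (- x) \<le> p (- x)"
          using CA by (auto simp: A_def)
        then show "- p (- x) \<le> f x"
          using sublinear_minus[of f x] by linarith
      qed
      have "sublinear (\<lambda>x. INF f\<in>C. f x)"
      proof (rule sublinear_INF[OF False bdd])
        fix f g x y
        assume fg: "f \<in> C" "g \<in> C"
        then have "f (x + y) \<le> f x + f y" "g (x + y) \<le> g x + g y"
          using CA by (auto simp: A_def sublinear_add)
        \<comment> \<open>The smaller of the two comparable functions \<open>f\<close> and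
          \<open>g\<close> serves as \<open>h\<close>.\<close>
        moreover have "f y \<le> g y \<or> g x \<le> f x"
          using chain[OF fg] by (auto simp: le_fun_def)
        ultimately show "\<exists>h\<in>C. h (x + y) \<le> f x + g y"
          using fg by (meson add_left_mono add_right_mono order_trans)
      next
        fix f x and t :: real
        assume "f \<in> C" "t \<ge> 0"
        then show "\<exists>g\<in>C. g (t *\<^sub>R x) \<le> t * f x"
          using CA by (intro bexI[of _ f]) (auto simp: A_def sublinear_def)
      qed
      moreover have le: "(INF f\<in>C. f x) \<le> f x" if "f \<in> C" for f x
        using cINF_lower[OF bdd that] .
      moreover have "(INF f\<in>C. f x) \<le> p x" for x
      proof -
        obtain f where "f \<in> C"
          using False by blast
        then show ?thesis
          using le[of f x] CA by (auto simp: A_def intro: order_trans)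
      qed
      ultimately show ?thesis
        by (intro bexI[of _ "\<lambda>x. INF f\<in>C. f x"]) (auto simp: A_def le_fun_def)
    qed
  qed
  then obtain m where m: "m \<in> A" and min: "\<And>f. f \<in> A \<Longrightarrow> f \<le> m \<Longrightarrow> f = m"
    by blast
  have "linear m"
  proof (rule minimal_sublinear_linear)
    show "sublinear m"
      using m by (simp add: A_def)
    fix f assume "sublinear f" "\<And>x. f x \<le> m x"
    then show "f = m"
      using m by (intro min) (auto simp: A_def le_fun_def intro: order_trans)
  qed
  then show ?thesis
    using m by (auto simp: A_def)
qed

text \<open>The functional to be extended is given by its graph \<open>W\<close>.\<close>

theorem Hahn_Banach:
  fixes W :: "('a::real_normed_vector \<times> real) set"
  assumes W: "subspace W" and "C \<ge> 0"
    and le: "\<And>s t. (s, t) \<in> W \<Longrightarrow> t \<le> C * norm s"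
  shows "\<exists>\<phi> :: 'a \<Rightarrow>\<^sub>L real. \<forall>s t. (s, t) \<in> W \<longrightarrow> blinfun_apply \<phi> s = t"
proof -
  \<comment> \<open>The infimum over \<open>w\<close> is the infimal convolution of
    \<open>C * norm\<close> with the functional whose graph is \<open>W\<close>. A linear minorant
    stays below \<open>C * norm\<close> (take \<open>w = 0\<close>) and below \<open>t\<close> at
    \<open>s\<close> (take \<open>w = (s, t)\<close>).\<close>
  define F where "F w y = C * norm (y - fst w) + snd w" for w and y :: 'a
  have bdd: "bdd_below ((\<lambda>w. F w y) ` W)" for y
  proof (rule bdd_belowI2)
    fix w assume "w \<in> W"
    then have "- w \<in> W"
      using W by (simp add: subspace_neg)
    then have "- snd w \<le> C * norm (fst w)"
      using le[of "- fst w" "- snd w"] by (cases w) simp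
    moreover have "C * norm (fst w) \<le> C * (norm y + norm (y - fst w))"
      using \<open>C \<ge> 0\<close> norm_triangle_ineq4[of y "y - fst w"] by (intro mult_left_mono) auto
    ultimately show "- (C * norm y) \<le> F w y"
      by (simp add: F_def algebra_simps)
  qed
  have "sublinear (\<lambda>y. INF w\<in>W. F w y)"
  proof (rule sublinear_INF[OF _ bdd])
    show "W \<noteq> {}"
      using W subspace_0 by blast
  next
    fix v w x y assume "v \<in> W" "w \<in> W"
    moreover have "C * norm (x + y - (fst v + fst w)) \<le> C * (norm (x - fst v) + norm (y - fst w))"
      using \<open>C \<ge> 0\<close> norm_triangle_ineq[of "x - fst v" "y - fst w"]
      by (intro mult_left_mono) (auto simp: algebra_simps)
    ultimately show "\<exists>u\<in>W. F u (x + y) \<le> F v x + F w y"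
      using W by (intro bexI[of _ "v + w"]) (auto simp: F_def algebra_simps subspace_add)
  next
    fix w x and t :: real assume "w \<in> W" "t \<ge> 0"
    moreover have "norm (t *\<^sub>R x - t *\<^sub>R fst w) = t * norm (x - fst w)"
      using \<open>t \<ge> 0\<close> by (simp flip: scaleR_diff_right)
    ultimately show "\<exists>u\<in>W. F u (t *\<^sub>R x) \<le> t * F w x"
      using W by (intro bexI[of _ "t *\<^sub>R w"]) (auto simp: F_def algebra_simps subspace_scale)
  qed
  then obtain l where "linear l" and l: "\<And>y. l y \<le> (INF w\<in>W. F w y)"
    using ex_linear_le_sublinear by blast
  have l_le: "l y \<le> F w y" if "w \<in> W" for w y
    using l[of y] cINF_lower[OF bdd that, of y] by linarith
  have "l y \<le> C * norm y" for y
    using l_le[OF subspace_0[OF W], of y] by (simp add: F_def)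
  then have "norm (l y) \<le> norm y * C" for y
    using linear_neg[OF \<open>linear l\<close>, of y]
    by (simp add: abs_le_iff mult.commute) (metis norm_minus_cancel)
  then have "bounded_linear l"
    using \<open>linear l\<close> by (intro bounded_linear_intro[of l C]) (auto simp: linear_add linear_cmul)
  moreover have "l s = t" if "(s, t) \<in> W" for s t
  proof (rule antisym)
    show "l s \<le> t"
      using l_le[OF that, of s] by (simp add: F_def)
    \<comment> \<open>The same bound for the negated pair, evaluated at \<open>- s\<close>.\<close>
    show "t \<le> l s"
      using l_le[OF subspace_neg[OF W that], of "- s"] linear_neg[OF \<open>linear l\<close>, of s]
      by (simp add: F_def)
  qed
  ultimately show ?thesis
    by (intro exI[of _ "Blinfun l"]) (auto simp: bounded_linear_Blinfun_apply)
qed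

section \<open>Functionals with prescribed values on a sequence with a lower estimate\<close>

lemma Holder_sum:
  fixes p q :: real
  assumes pq: "p > 1" "q > 1" "1/p + 1/q = 1" and "finite I"
  shows "(\<Sum>i\<in>I. \<bar>a i * b i\<bar>) \<le>
    (\<Sum>i\<in>I. \<bar>a i\<bar> powr p) powr (1/p) * (\<Sum>i\<in>I. \<bar>b i\<bar> powr q) powr (1/q)"
proof -
  define A B where "A = (\<Sum>i\<in>I. \<bar>a i\<bar> powr p)" and "B = (\<Sum>i\<in>I. \<bar>b i\<bar> powr q)"
  have nonneg: "A \<ge> 0" "B \<ge> 0"
    by (simp_all add: A_def B_def sum_nonneg)
  show ?thesis
  proof (cases "A = 0 \<or> B = 0")
    case True
    then have "a i * b i = 0" if "i \<in> I" for i
      using \<open>finite I\<close> that by (auto simp: A_def B_def sum_nonneg_eq_0_iff)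
    then have "(\<Sum>i\<in>I. \<bar>a i * b i\<bar>) = 0"
      by (intro sum.neutral) simp
    also have "\<dots> \<le> A powr (1/p) * B powr (1/q)"
      by simp
    finally show ?thesis
      by (simp add: A_def B_def)
  next
    case False
    then have pos: "A > 0" "B > 0"
      using nonneg by auto
    \<comment> \<open>Normalising both factors makes the terms of Young's inequality add up to
      \<open>1/p + 1/q = 1\<close>.\<close>
    define u v where "u = A powr (1/p)" and "v = B powr (1/q)"
    have uv: "u > 0" "v > 0" "u powr p = A" "v powr q = B"
      using pos pq by (simp_all add: u_def v_def powr_powr)
    have "(\<Sum>i\<in>I. \<bar>a i * b i\<bar>) / (u * v) = (\<Sum>i\<in>I. (\<bar>a i\<bar> / u) * (\<bar>b i\<bar> / v))"
      by (simp add: sum_divide_distrib abs_mult)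
    also have "\<dots> \<le> (\<Sum>i\<in>I. (\<bar>a i\<bar> / u) powr p / p + (\<bar>b i\<bar> / v) powr q / q)"
      using uv pq by (intro sum_mono Youngs_inequality) auto
    also have "\<dots> = A / A / p + B / B / q"
      using uv by (simp add: sum.distrib powr_divide A_def[symmetric] B_def[symmetric] flip: sum_divide_distrib)
    also have "\<dots> = 1"
      using pos pq by simp
    finally show ?thesis
      using uv by (simp add: field_simps) (simp add: u_def v_def A_def B_def mult.commute)
  qed
qed

lemma span_range_sum:
  fixes z :: "nat \<Rightarrow> 'a::real_vector"
  assumes "v \<in> span (range z)"
  shows "\<exists>n a. v = (\<Sum>i<n. a i *\<^sub>R z i)"
  using assms
proof (induction rule: span_induct_alt)
  case base
  show ?case
    by (rule exI[of _ 0]) simp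
next
  case (step c w v)
  then obtain k n a where w: "w = z k" and v: "v = (\<Sum>i<n. a i *\<^sub>R z i)"
    by blast
  define N where "N = max n (Suc k)"
  define a' where "a' i = (if i < n then a i else 0) + (if i = k then c else 0)" for i
  have "(\<Sum>i<N. (if i < n then a i else 0) *\<^sub>R z i) = (\<Sum>i<n. a i *\<^sub>R z i)"
    by (rule sum.mono_neutral_cong_right) (auto simp: N_def)
  moreover have "(\<Sum>i<N. (if i = k then c else 0) *\<^sub>R z i) = c *\<^sub>R z k"
    by (subst sum.mono_neutral_cong_right[of _ "{k}" _ "\<lambda>i. c *\<^sub>R z i"]) (auto simp: N_def)
  ultimately have "c *\<^sub>R w + v = (\<Sum>i<N. a' i *\<^sub>R z i)"
    by (simp add: a'_def scaleR_add_left sum.distrib w v)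
  then show ?case
    by blast
qed

text \<open>The pairs \<open>(x i, b i)\<close> span the graph of the wanted functional; the bound
  dominates it by \<open>C * norm\<close> and forces it to be single-valued.\<close>

lemma ex_functional_interpolating:
  fixes x :: "nat \<Rightarrow> 'a::real_normed_vector"
  assumes "C \<ge> 0"
    and le: "\<And>n a. (\<Sum>i<n. a i * b i) \<le> C * norm (\<Sum>i<n. a i *\<^sub>R x i)"
  shows "\<exists>\<phi> :: 'a \<Rightarrow>\<^sub>L real. \<forall>i. blinfun_apply \<phi> (x i) = b i"
proof -
  have "\<exists>\<phi> :: 'a \<Rightarrow>\<^sub>L real. \<forall>s t. (s, t) \<in> span (range (\<lambda>i. (x i, b i))) \<longrightarrow> blinfun_apply \<phi> s = t"
  proof (rule Hahn_Banach[OF subspace_span \<open>C \<ge> 0\<close>])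
    fix s :: 'a and t assume "(s, t) \<in> span (range (\<lambda>i. (x i, b i)))"
    then obtain n a where "(s, t) = (\<Sum>i<n. a i *\<^sub>R (x i, b i))"
      using span_range_sum by blast
    then have "s = (\<Sum>i<n. a i *\<^sub>R x i)" "t = (\<Sum>i<n. a i * b i)"
      by (simp_all add: prod_eq_iff fst_sum snd_sum)
    then show "t \<le> C * norm s"
      using le by simp
  qed
  then obtain \<phi> :: "'a \<Rightarrow>\<^sub>L real"
    where \<phi>: "\<And>s t. (s, t) \<in> span (range (\<lambda>i. (x i, b i))) \<Longrightarrow> blinfun_apply \<phi> s = t"
    by auto
  have "blinfun_apply \<phi> (x i) = b i" for i
    by (intro \<phi> span_base) auto
  then show ?thesis
    by blast
qed

text \<open>Duality: Hoelder bounds the pairing of \<open>a\<close> and \<open>b\<close> by the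
  product of their norms in l_q and l_q', and the lower estimate controls the first of these.
  Replacing \<open>norm (a i *\<^sub>R x i)\<close> by \<open>\<bar>a i\<bar>\<close> costs a factor
  \<open>\<delta>\<close>, whence the constant \<open>K / (c * \<delta>)\<close>.\<close>

lemma lower_estimate_imp_functional:
  fixes x :: "nat \<Rightarrow> 'a::banach" and q q' :: real
  assumes q: "q > 1" "q' > 1" "1/q + 1/q' = 1"
    and "lower_estimate (ereal q) x" and "\<delta> > 0" and \<delta>: "\<And>n. \<delta> \<le> norm (x n)"
    and b: "summable (\<lambda>i. \<bar>b i\<bar> powr q')"
  shows "\<exists>\<phi> :: 'a \<Rightarrow>\<^sub>L real. \<forall>i. blinfun_apply \<phi> (x i) = b i"
proof -
  obtain c where "c > 0" and c: "\<And>n a. n \<ge> 1 \<Longrightarrow>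
      c * lq_norm (ereal q) n (\<lambda>i. norm (a i *\<^sub>R x i)) \<le> norm (\<Sum>i<n. a i *\<^sub>R x i)"
    using assms(4) unfolding lower_estimate_def by blast
  define K where "K = (\<Sum>i. \<bar>b i\<bar> powr q') powr (1/q')"
  show ?thesis
  proof (rule ex_functional_interpolating)
    show "K / (c * \<delta>) \<ge> 0"
      using \<open>c > 0\<close> \<open>\<delta> > 0\<close> by (simp add: K_def)
    fix n :: nat and a :: "nat \<Rightarrow> real"
    let ?A = "(\<Sum>i<n. \<bar>a i\<bar> powr q) powr (1/q)"
    show "(\<Sum>i<n. a i * b i) \<le> K / (c * \<delta>) * norm (\<Sum>i<n. a i *\<^sub>R x i)"
    proof (cases "n = 0")
      case False
      have "?A * \<delta> = (\<Sum>i<n. (\<bar>a i\<bar> * \<delta>) powr q) powr (1/q)"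
        using q \<open>\<delta> > 0\<close>
        by (simp add: powr_mult sum_nonneg powr_powr flip: sum_distrib_right)
      also have "\<dots> \<le> lq_norm (ereal q) n (\<lambda>i. norm (a i *\<^sub>R x i))"
        using q \<open>\<delta> > 0\<close> \<delta>
        by (auto simp: lq_norm_def intro!: powr_mono2 sum_mono sum_nonneg mult_left_mono)
      finally have "c * (?A * \<delta>) \<le> c * lq_norm (ereal q) n (\<lambda>i. norm (a i *\<^sub>R x i))"
        using \<open>c > 0\<close> by simp
      also have "\<dots> \<le> norm (\<Sum>i<n. a i *\<^sub>R x i)"
        using c False by simp
      finally have A: "?A \<le> norm (\<Sum>i<n. a i *\<^sub>R x i) / (c * \<delta>)"
        using \<open>c > 0\<close> \<open>\<delta> > 0\<close> by (simp add: field_simps)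
      have "(\<Sum>i<n. a i * b i) \<le> (\<Sum>i<n. \<bar>a i * b i\<bar>)"
        by (intro sum_mono) simp
      also have "\<dots> \<le> ?A * (\<Sum>i<n. \<bar>b i\<bar> powr q') powr (1/q')"
        using q by (intro Holder_sum) auto
      also have "\<dots> \<le> ?A * K"
        unfolding K_def using q b
        by (intro mult_left_mono powr_mono2 sum_le_suminf sum_nonneg) auto
      also have "\<dots> \<le> norm (\<Sum>i<n. a i *\<^sub>R x i) / (c * \<delta>) * K"
        using A by (intro mult_right_mono) (auto simp: K_def)
      finally show ?thesis
        by (simp add: mult.commute)
    qed simp
  qed
qed

section \<open>Blocks of binary digits\<close>

text \<open>An event decided by the first \<open>M\<close> binary digits, that is, a union of dyadic
  intervals of level \<open>M\<close>. The range of \<open>S\<close> keeps it inside [0,1) and makes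
  \<open>S\<close> finite.\<close>

definition dyadic_set :: "nat \<Rightarrow> real set \<Rightarrow> bool" where
  "dyadic_set M B \<longleftrightarrow> (\<exists>S\<subseteq>{0..<2 ^ M}. B = {\<omega>. \<lfloor>2 ^ M * \<omega>\<rfloor> \<in> S})"

text \<open>The binary digits of \<open>\<omega>\<close> at the positions \<open>N + 1, \<dots>, N + i\<close> after the point vanish.\<close>

definition zero_block :: "nat \<Rightarrow> nat \<Rightarrow> real set" where
  "zero_block N i = {\<omega>. 2 ^ i dvd \<lfloor>2 ^ (N + i) * \<omega>\<rfloor>}"

text \<open>Integer division by \<open>2 ^ i\<close> deletes the last \<open>i\<close> binary
  digits; this links the levels \<open>N\<close> and \<open>N + i\<close>.\<close>

lemma floor_power2_div: "\<lfloor>2 ^ N * \<omega>\<rfloor> = \<lfloor>2 ^ (N + i) * \<omega> :: real\<rfloor> div 2 ^ i"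
proof -
  have "2 ^ N * \<omega> = 2 ^ (N + i) * \<omega> / real_of_int (2 ^ i)"
    by (simp add: power_add)
  then show ?thesis
    by (simp only: floor_divide_real_eq_div zero_le_power zero_le_numeral)
qed

lemma floor_preimage_measure:
  assumes "finite S"
  shows "{\<omega> :: real. \<lfloor>2 ^ M * \<omega>\<rfloor> \<in> S} \<in> lmeasurable"
    and "measure lebesgue {\<omega> :: real. \<lfloor>2 ^ M * \<omega>\<rfloor> \<in> S} = card S / 2 ^ M"
proof -
  have "{\<omega> :: real. \<lfloor>2 ^ M * \<omega>\<rfloor> \<in> S} \<in> lmeasurable \<and>
    measure lebesgue {\<omega> :: real. \<lfloor>2 ^ M * \<omega>\<rfloor> \<in> S} = card S / 2 ^ M"
    using assms
  proof (induction S rule: finite_induct)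
    case (insert m S)
    let ?I = "{real_of_int m / 2 ^ M..<(real_of_int m + 1) / 2 ^ M}"
    let ?T = "{\<omega>. \<lfloor>2 ^ M * \<omega>\<rfloor> \<in> S}"
    have I_iff: "\<omega> \<in> ?I \<longleftrightarrow> \<lfloor>2 ^ M * \<omega>\<rfloor> = m" for \<omega>
      by (auto simp: floor_eq_iff field_simps)
    then have eq: "{\<omega>. \<lfloor>2 ^ M * \<omega>\<rfloor> \<in> insert m S} = ?I \<union> ?T" and disj: "?I \<inter> ?T = {}"
      using insert.hyps by (blast, auto simp: I_iff simp del: atLeastLessThan_iff)
    have "?I \<in> lmeasurable"
      by (intro bounded_set_imp_lmeasurable bounded_Ico) auto
    moreover have "measure lebesgue ?I = 1 / 2 ^ M"
      by (simp add: divide_right_mono field_simps)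
    ultimately show ?case
      unfolding eq using insert disj by (simp add: fmeasurable.Un measure_Un3 add_divide_distrib)
  qed simp
  then show "{\<omega> :: real. \<lfloor>2 ^ M * \<omega>\<rfloor> \<in> S} \<in> lmeasurable"
    and "measure lebesgue {\<omega> :: real. \<lfloor>2 ^ M * \<omega>\<rfloor> \<in> S} = card S / 2 ^ M"
    by auto
qed

lemma dyadic_set_lmeasurable: "dyadic_set M B \<Longrightarrow> B \<in> lmeasurable"
  by (auto simp: dyadic_set_def intro!: floor_preimage_measure finite_subset[of _ "{0..<2 ^ M}"])

lemma dyadic_set_unit: "dyadic_set 0 {0..<1}"
  unfolding dyadic_set_def by (rule exI[of _ "{0}"]) (auto simp: floor_eq_iff)

text \<open>Conditions on the first \<open>N\<close> and on the first \<open>N + i\<close> digits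
  merge into one at the finer level, within the index range that \<open>dyadic_set\<close>
  demands.\<close>

lemma dyadic_set_split:
  fixes P :: "int \<Rightarrow> bool"
  assumes "S \<subseteq> {0..<2 ^ N}"
  shows "{\<omega> :: real. \<lfloor>2 ^ N * \<omega>\<rfloor> \<in> S \<and> P \<lfloor>2 ^ (N + i) * \<omega>\<rfloor>} =
      {\<omega>. \<lfloor>2 ^ (N + i) * \<omega>\<rfloor> \<in> {m. m div 2 ^ i \<in> S \<and> P m}}"
    and "{m. m div 2 ^ i \<in> S \<and> P m} \<subseteq> {0..<2 ^ (N + i)}"
proof -
  show "{\<omega> :: real. \<lfloor>2 ^ N * \<omega>\<rfloor> \<in> S \<and> P \<lfloor>2 ^ (N + i) * \<omega>\<rfloor>} =
      {\<omega>. \<lfloor>2 ^ (N + i) * \<omega>\<rfloor> \<in> {m. m div 2 ^ i \<in> S \<and> P m}}"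
    by (simp add: floor_power2_div[of N _ i])
  have "m \<in> {0..<2 ^ (N + i)}" if "m div 2 ^ i \<in> S" for m :: int
  proof -
    have "0 \<le> m div 2 ^ i" and less: "m div 2 ^ i < 2 ^ N"
      using assms that by auto
    then have "0 \<le> m"
      by (simp add: pos_imp_zdiv_nonneg_iff)
    moreover have "m < (m div 2 ^ i + 1) * 2 ^ i"
    proof -
      have "m mod 2 ^ i < 2 ^ i"
        by simp
      then show ?thesis
        unfolding distrib_right mult_1 by (metis add_strict_left_mono div_mult_mod_eq)
    qed
    moreover have "(m div 2 ^ i + 1) * 2 ^ i \<le> 2 ^ N * 2 ^ i"
      using less by (intro mult_right_mono) auto
    ultimately have "0 \<le> m \<and> m < 2 ^ N * 2 ^ i"
      by (meson less_le_trans)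
    then show ?thesis
      by (simp add: power_add)
  qed
  then show "{m. m div 2 ^ i \<in> S \<and> P m} \<subseteq> {0..<2 ^ (N + i)}"
    by blast
qed

lemma dyadic_set_mono:
  assumes "dyadic_set M B" "M \<le> N"
  shows "dyadic_set N B"
proof -
  obtain S where S: "S \<subseteq> {0..<2 ^ M}" "B = {\<omega>. \<lfloor>2 ^ M * \<omega>\<rfloor> \<in> S}"
    using assms by (auto simp: dyadic_set_def)
  obtain i where "N = M + i"
    using assms le_Suc_ex by blast
  then show ?thesis
    using dyadic_set_split[OF S(1), where P = "\<lambda>_. True" and i = i] S(2) unfolding dyadic_set_def by auto
qed

lemma dyadic_set_Diff_zero_block:
  assumes "dyadic_set N B"
  shows "dyadic_set (N + i) (B - zero_block N i)"
proof -
  obtain S where S: "S \<subseteq> {0..<2 ^ N}" "B = {\<omega>. \<lfloor>2 ^ N * \<omega>\<rfloor> \<in> S}"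
    using assms by (auto simp: dyadic_set_def)
  have "B - zero_block N i = {\<omega>. \<lfloor>2 ^ N * \<omega>\<rfloor> \<in> S \<and> \<not> 2 ^ i dvd \<lfloor>2 ^ (N + i) * \<omega>\<rfloor>}"
    by (auto simp: S(2) zero_block_def)
  then show ?thesis
    using dyadic_set_split[OF S(1), where P = "\<lambda>m. \<not> 2 ^ i dvd m" and i = i] unfolding dyadic_set_def by blast
qed

text \<open>Independence by counting: each cell \<open>m\<close> in \<open>S\<close> has exactly one
  continuation by \<open>i\<close> zeros, namely \<open>2 ^ i * m\<close>, so the number of cells is
  kept while their length shrinks by \<open>2 ^ i\<close>.\<close>

lemma dyadic_set_Int_zero_block:
  assumes "dyadic_set N B"
  shows "B \<inter> zero_block N i \<in> lmeasurable"
    and "measure lebesgue (B \<inter> zero_block N i) = measure lebesgue B / 2 ^ i"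
proof -
  obtain S where S: "S \<subseteq> {0..<2 ^ N}" "B = {\<omega>. \<lfloor>2 ^ N * \<omega>\<rfloor> \<in> S}"
    using assms by (auto simp: dyadic_set_def)
  have "finite S"
    using S(1) finite_subset by blast
  have "B \<inter> zero_block N i = {\<omega>. \<lfloor>2 ^ N * \<omega>\<rfloor> \<in> S \<and> 2 ^ i dvd \<lfloor>2 ^ (N + i) * \<omega>\<rfloor>}"
    by (auto simp: S(2) zero_block_def)
  also have "\<dots> = {\<omega>. \<lfloor>2 ^ (N + i) * \<omega>\<rfloor> \<in> {m. m div 2 ^ i \<in> S \<and> 2 ^ i dvd m}}"
    by (rule dyadic_set_split[OF S(1)])
  also have "{m. m div 2 ^ i \<in> S \<and> 2 ^ i dvd m} = (\<lambda>m. 2 ^ i * m) ` S"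
    by (auto simp: image_iff)
  finally have eq: "B \<inter> zero_block N i = {\<omega>. \<lfloor>2 ^ (N + i) * \<omega>\<rfloor> \<in> (\<lambda>m. 2 ^ i * m) ` S}" .
  show "B \<inter> zero_block N i \<in> lmeasurable"
    unfolding eq using \<open>finite S\<close> by (intro floor_preimage_measure) auto
  have "card ((\<lambda>m::int. 2 ^ i * m) ` S) = card S"
    by (intro card_image) (auto simp: inj_on_def)
  then show "measure lebesgue (B \<inter> zero_block N i) = measure lebesgue B / 2 ^ i"
    unfolding eq unfolding S(2) using \<open>finite S\<close> by (subst (1 2) floor_preimage_measure) (simp_all add: power_add)
qed

text \<open>A quantitative second Borel-Cantelli lemma. The blocks occupy disjoint ranges of digits,
  so avoiding the \<open>k\<close>-th one multiplies the measure by \<open>1 - 1 / 2 ^ e k\<close>,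
  which is at most \<open>k / (k + 1)\<close>; the product over \<open>m \<le> k < K\<close>
  telescopes to \<open>m / K\<close>.\<close>

lemma measure_avoid_zero_blocks:
  assumes N: "\<And>k. N k + e k \<le> N (Suc k)" and e: "\<And>k. 2 ^ e k \<le> Suc k"
    and "m \<ge> 1" "m \<le> K"
  shows "dyadic_set (N K) ({0..<1} - (\<Union>k\<in>{m..<K}. zero_block (N k) (e k))) \<and>
    measure lebesgue ({0..<1} - (\<Union>k\<in>{m..<K}. zero_block (N k) (e k))) \<le> m / K"
  using \<open>m \<le> K\<close>
proof (induction K rule: dec_induct)
  \<comment> \<open>The union is empty and the bound reads \<open>1 \<le> m / m\<close>, hence the
    need for \<open>m \<ge> 1\<close>.\<close>
  case base
  then show ?case
    using dyadic_set_mono[OF dyadic_set_unit, of "N m"] \<open>m \<ge> 1\<close>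
    by simp
next
  case (step K)
  let ?B = "{0..<1} - (\<Union>k\<in>{m..<K}. zero_block (N k) (e k))"
  let ?Z = "zero_block (N K) (e K)"
  have B: "dyadic_set (N K) ?B" and le: "measure lebesgue ?B \<le> m / K"
    using step.IH by auto
  have eq: "{0..<1} - (\<Union>k\<in>{m..<Suc K}. zero_block (N k) (e k)) = ?B - ?Z"
    using step.hyps by (auto simp: less_Suc_eq)
  have "measure lebesgue (?B - ?Z) = measure lebesgue ?B - measure lebesgue (?B \<inter> ?Z)"
    using dyadic_set_lmeasurable[OF B] dyadic_set_Int_zero_block(1)[OF B, of "e K"]
    by (subst measurable_measure_Diff[symmetric]) (auto simp: Diff_Int2 Diff_Int fmeasurableD)
  also have "\<dots> = measure lebesgue ?B * (1 - 1 / 2 ^ e K)"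
    by (simp add: dyadic_set_Int_zero_block(2)[OF B] algebra_simps)
  also have "\<dots> \<le> measure lebesgue ?B * (1 - 1 / Suc K)"
    using e[of K] of_nat_mono[of "2 ^ e K" "Suc K", where 'a = real]
    by (intro mult_left_mono diff_left_mono divide_left_mono) auto
  also have "\<dots> \<le> m / K * (1 - 1 / Suc K)"
    using le by (intro mult_right_mono) auto
  also have "\<dots> = m / Suc K"
    using step.hyps \<open>m \<ge> 1\<close> by (simp add: field_simps)
  finally show ?case
    unfolding eq using dyadic_set_mono[OF dyadic_set_Diff_zero_block[OF B] N] by blast
qed

text \<open>The points that avoid all blocks from the \<open>m\<close>-th on lie in sets of measure
  at most \<open>m / K\<close> for every \<open>K \<ge> m\<close>; letting \<open>K\<close> grow
  makes them negligible.\<close>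

lemma AE_infinitely_many_zero_blocks:
  assumes N: "\<And>k. N k + e k \<le> N (Suc k)" and e: "\<And>k. 2 ^ e k \<le> Suc k"
  shows "AE \<omega> in lebesgue. \<omega> \<in> {0..<1} \<longrightarrow> (\<forall>m. \<exists>k\<ge>m. \<omega> \<in> zero_block (N k) (e k))"
proof -
  define E where "E m = {0..<1} - (\<Union>k\<in>{m..}. zero_block (N k) (e k))" for m
  have null: "E m \<in> null_sets lebesgue" if "m \<ge> 1" for m
  proof -
    have "negligible (E m)"
      unfolding negligible_outer_le
    proof (intro allI impI)
      fix \<epsilon> :: real assume "\<epsilon> > 0"
      obtain K0 :: nat where K0: "m / \<epsilon> < K0"
        using reals_Archimedean2 by blast
      define K where "K = max m K0"
      have "m / \<epsilon> \<le> K"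
        using K0 by (simp add: K_def)
      then have "m / K \<le> \<epsilon>"
        using \<open>\<epsilon> > 0\<close> that by (simp add: K_def field_simps)
      moreover have "m \<le> K"
        by (simp add: K_def)
      moreover have "E m \<subseteq> {0..<1} - (\<Union>k\<in>{m..<K}. zero_block (N k) (e k))"
        by (auto simp: E_def)
      ultimately show "\<exists>T. E m \<subseteq> T \<and> T \<in> lmeasurable \<and> measure lebesgue T \<le> \<epsilon>"
        using measure_avoid_zero_blocks[OF N e that, of K] dyadic_set_lmeasurable
        by (meson order_trans)
    qed
    then show ?thesis
      by (simp add: negligible_iff_null_sets)
  qed
  \<comment> \<open>The shift by \<open>Suc\<close> skips \<open>E 0\<close>, which
    \<open>null\<close> does not cover; \<open>k \<ge> Suc m\<close> still yields
    \<open>k \<ge> m\<close>.\<close>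
  have "AE \<omega> in lebesgue. \<forall>m. \<omega> \<notin> E (Suc m)"
    unfolding AE_all_countable by (intro allI AE_not_in null) simp
  then show ?thesis
  proof (rule eventually_mono, intro impI allI)
    fix \<omega> :: real and m
    assume "\<forall>m. \<omega> \<notin> E (Suc m)" "\<omega> \<in> {0..<1}"
    then obtain k where "k \<ge> Suc m" "\<omega> \<in> zero_block (N k) (e k)"
      unfolding E_def by blast
    then show "\<exists>k\<ge>m. \<omega> \<in> zero_block (N k) (e k)"
      using Suc_leD by blast
  qed
qed

section \<open>Independent functions with heavy tails\<close>

lemma finite_measure_unit_leb: "finite_measure unit_leb"
  by (simp add: finite_measure_lebesgue_on)

lemma simple_function_in_Lp_space:
  fixes f :: "real \<Rightarrow> 'a::banach"
  assumes f: "simple_function unit_leb f"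
  shows "f \<in> Lp_space p"
proof -
  have "strongly_measurable f"
    using f unfolding strongly_measurable_def by (intro exI[of _ "\<lambda>_. f"]) simp
  moreover have "integrable unit_leb (\<lambda>\<omega>. norm (f \<omega>) powr p)"
  proof -
    have h: "simple_function unit_leb (\<lambda>\<omega>. norm (f \<omega>) powr p)"
      using f by (rule simple_function_compose1)
    define B where "B = Max ((\<lambda>\<omega>. norm (f \<omega>) powr p) ` space unit_leb)"
    have "norm (f \<omega>) powr p \<le> B" if "\<omega> \<in> space unit_leb" for \<omega>
      unfolding B_def using simple_functionD(1)[OF h] that by (intro Max_ge) auto
    then show ?thesis
      using h by (intro finite_measure.integrable_const_bound[OF finite_measure_unit_leb, of _ B]
          borel_measurable_simple_function AE_I2) auto
  qed
  ultimately show ?thesis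
    by (simp add: Lp_space_def)
qed

lemma Lp_norm_nonneg: "0 \<le> Lp_norm p f"
  by (simp add: Lp_norm_def)

lemma Lp_norm_scaleR:
  fixes h :: "real \<Rightarrow> real"
  assumes "p \<ge> 1"
  shows "Lp_norm p (\<lambda>\<omega>. h \<omega> *\<^sub>R v) = Lp_norm p h * norm v"
  using assms by (simp add: Lp_norm_def powr_mult powr_powr)

text \<open>
  A function on the unit interval with \<open>\<mu>{g \<ge> t}\<close> of order \<open>t\<^sup>-\<^sup>s\<close> for \<open>1 \<le> t \<le> 2\<^bsup>n/s\<^esup>\<close>; it only depends
  on the binary digits at the positions \<open>n\<^sup>2 + 1, \<dots>, n\<^sup>2 + n\<close>, so that different \<open>n\<close> give
  independent functions.
\<close>

definition heavy_tail :: "real \<Rightarrow> real \<Rightarrow> nat \<Rightarrow> real \<Rightarrow> real" where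
  "heavy_tail p s n \<omega> =
     (\<Sum>i\<le>n. 2 powr (i * p / s) * indicator ({0..<1} \<inter> zero_block (n\<^sup>2) i) \<omega>) powr (1 / p)"

lemma unit_zero_block_lmeasurable: "{0..<1} \<inter> zero_block N i \<in> lmeasurable"
  using dyadic_set_Int_zero_block(1)[OF dyadic_set_mono[OF dyadic_set_unit]] by simp

lemma measure_unit_zero_block: "measure unit_leb ({0..<1} \<inter> zero_block N i) = 1 / 2 ^ i"
proof -
  have "measure unit_leb ({0..<1} \<inter> zero_block N i) = measure lebesgue ({0..<1} \<inter> zero_block N i)"
    by (rule measure_restrict_space) auto
  also have "\<dots> = 1 / 2 ^ i"
    using dyadic_set_Int_zero_block(2)[OF dyadic_set_mono[OF dyadic_set_unit, of N]]
    by simp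
  finally show ?thesis .
qed

lemma unit_zero_block_sets: "{0..<1} \<inter> zero_block N i \<in> sets unit_leb"
  using unit_zero_block_lmeasurable by (subst sets_restrict_space_iff) (auto simp: fmeasurableD)

lemma simple_function_heavy_tail: "simple_function unit_leb (heavy_tail p s n)"
proof -
  have "simple_function unit_leb
      (\<lambda>\<omega>. \<Sum>i\<le>n. 2 powr (i * p / s) * indicator ({0..<1} \<inter> zero_block (n\<^sup>2) i) \<omega> :: real)"
    using unit_zero_block_sets
    by (intro simple_function_sum simple_function_mult simple_function_const simple_function_indicator)
  then show ?thesis
    unfolding heavy_tail_def by (rule simple_function_compose1)
qed

lemma heavy_tail_ge:
  assumes "p > 0" "i \<le> n" "\<omega> \<in> {0..<1}" "\<omega> \<in> zero_block (n\<^sup>2) i"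
  shows "2 powr (i / s) \<le> heavy_tail p s n \<omega>"
proof -
  let ?F = "\<lambda>i. 2 powr (i * p / s) * indicator ({0..<1} \<inter> zero_block (n\<^sup>2) i) \<omega> :: real"
  have "2 powr (i * p / s) = ?F i"
    using assms by simp
  also have "\<dots> \<le> (\<Sum>i\<le>n. ?F i)"
    using assms by (intro member_le_sum) auto
  finally have "(2 powr (i * p / s)) powr (1 / p) \<le> heavy_tail p s n \<omega>"
    unfolding heavy_tail_def using assms by (intro powr_mono2) auto
  then show ?thesis
    using assms by (simp add: powr_powr)
qed

text \<open>The outer exponent \<open>1 / p\<close> of \<open>heavy_tail\<close> cancels, so the
  integral is a sum of terms \<open>2 powr (i * p / s) / 2 ^ i\<close>: a geometric series of ratio
  below 1 because \<open>p < s\<close>, with a bound free of \<open>n\<close>.\<close>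

lemma Lp_norm_heavy_tail_le:
  assumes "p \<ge> 1" "s > p"
  shows "Lp_norm p (heavy_tail p s n) \<le> (1 / (1 - 2 powr (p / s - 1))) powr (1 / p)"
proof -
  let ?F = "\<lambda>i \<omega>. 2 powr (i * p / s) * indicator ({0..<1} \<inter> zero_block (n\<^sup>2) i) \<omega> :: real"
  let ?r = "2 powr (p / s - 1)"
  have r: "0 \<le> ?r" "?r < 1"
    using assms by (simp_all add: powr_less_one)
  have "norm (heavy_tail p s n \<omega>) powr p = (\<Sum>i\<le>n. ?F i \<omega>)" for \<omega>
    using assms by (simp add: heavy_tail_def powr_powr sum_nonneg)
  then have "(\<integral>\<omega>. norm (heavy_tail p s n \<omega>) powr p \<partial>unit_leb) = (\<integral>\<omega>. (\<Sum>i\<le>n. ?F i \<omega>) \<partial>unit_leb)"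
    by simp
  also have "\<dots> = (\<Sum>i\<le>n. \<integral>\<omega>. ?F i \<omega> \<partial>unit_leb)"
    using unit_zero_block_sets finite_measure.emeasure_finite[OF finite_measure_unit_leb]
    by (intro Bochner_Integration.integral_sum integrable_mult_right integrable_real_indicator)
      (auto simp: less_top)
  also have "\<dots> = (\<Sum>i\<le>n. 2 powr (i * p / s) / 2 ^ i)"
    using unit_zero_block_sets sets.sets_into_space[OF unit_zero_block_sets]
    by (intro sum.cong refl) (simp add: Int_absorb2 measure_unit_zero_block)
  also have "\<dots> = (\<Sum>i\<le>n. ?r ^ i)"
    by (intro sum.cong refl)
      (simp add: powr_powr algebra_simps flip: powr_realpow powr_diff)
  also have "\<dots> \<le> (\<Sum>i. ?r ^ i)"
    using r by (intro sum_le_suminf summable_geometric) auto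
  also have "\<dots> = 1 / (1 - ?r)"
    using r by (intro suminf_geometric) auto
  finally show ?thesis
    unfolding Lp_norm_def using assms by (intro powr_mono2) auto
qed

section \<open>Failure of property \<open>(E\<^sub>p)\<close>\<close>

lemma not_property_E:
  fixes x :: "nat \<Rightarrow> 'a::banach" and p q q' :: real
  assumes q: "q > 1" "q' > 1" "1/q + 1/q' = 1" and p: "1 \<le> p" "p < q'"
    and null: "weakly_null x" and semi: "semi_normalized x" and lower: "lower_estimate (ereal q) x"
  shows "\<not> property_E TYPE('a) p"
proof
  assume E: "property_E TYPE('a) p"
  obtain s where s: "p < s" "s < q'"
    using p dense by blast
  define g where "g = heavy_tail p s"
  define f where "f n \<omega> = g n \<omega> *\<^sub>R x n" for n \<omega>
  define K where "K = (1 / (1 - 2 powr (p / s - 1))) powr (1 / p)"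
  have gK: "Lp_norm p (g n) \<le> K" for n
    using p s by (simp add: g_def K_def Lp_norm_heavy_tail_le)
  \<comment> \<open>The type of \<open>v\<close> is left open because the fact is used both for
    vectors of X and for the scalars \<open>\<phi> (x n)\<close>.\<close>
  have g_simple: "simple_function unit_leb (\<lambda>\<omega>. g n \<omega> *\<^sub>R v)" for n and v :: "'b::banach"
    unfolding g_def by (rule simple_function_compose1[OF simple_function_heavy_tail])
  obtain M where M: "\<And>n. norm (x n) \<le> M"
    using semi unfolding semi_normalized_def bdd_above_def by auto
  define \<delta> where "\<delta> = (INF n. norm (x n))"
  have "\<delta> > 0"
    using semi by (simp add: semi_normalized_def \<delta>_def)
  have \<delta>: "\<delta> \<le> norm (x n)" for n
    unfolding \<delta>_def by (intro cINF_lower bdd_belowI2[of _ 0]) auto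

  have "Lp_bounded p f"
    unfolding Lp_bounded_def
  proof (intro conjI allI bdd_aboveI2)
    fix n
    show "f n \<in> Lp_space p"
      unfolding f_def by (rule simple_function_in_Lp_space[OF g_simple])
    have "Lp_norm p (f n) = Lp_norm p (g n) * norm (x n)"
      unfolding f_def using p by (intro Lp_norm_scaleR)
    also have "\<dots> \<le> K * M"
      using gK M by (intro mult_mono) (auto simp: K_def Lp_norm_nonneg)
    finally show "Lp_norm p (f n) \<le> K * M" .
  qed
  moreover have "strongly_measurable (\<lambda>_. 0 :: 'a)"
    unfolding strongly_measurable_def by (intro exI[of _ "\<lambda>_ _. 0"]) simp
  moreover have "tendsto_scalarly_Lp p f (\<lambda>_. 0)"
    unfolding tendsto_scalarly_Lp_def tendsto_Lp_def
  proof (intro allI conjI)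
    fix \<phi> :: "'a \<Rightarrow>\<^sub>L real"
    have \<phi>f: "blinfun_apply \<phi> (f n \<omega>) = g n \<omega> *\<^sub>R blinfun_apply \<phi> (x n)" for n \<omega>
      by (simp add: f_def blinfun.scaleR_right)
    show "(\<lambda>\<omega>. blinfun_apply \<phi> (f n \<omega>)) \<in> Lp_space p" for n
      unfolding \<phi>f by (rule simple_function_in_Lp_space[OF g_simple])
    show "(\<lambda>\<omega>. blinfun_apply \<phi> 0) \<in> Lp_space p"
      by (rule simple_function_in_Lp_space) simp
    have "Lp_norm p (\<lambda>\<omega>. blinfun_apply \<phi> (f n \<omega>) - blinfun_apply \<phi> 0)
        = Lp_norm p (g n) * \<bar>blinfun_apply \<phi> (x n)\<bar>" for n
      using Lp_norm_scaleR[OF p(1), of "g n" "blinfun_apply \<phi> (x n)"] by (simp add: \<phi>f)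
    moreover have "(\<lambda>n. Lp_norm p (g n) * \<bar>blinfun_apply \<phi> (x n)\<bar>) \<longlonglongrightarrow> 0"
    proof (rule tendsto_0_le)
      show "(\<lambda>n. blinfun_apply \<phi> (x n)) \<longlonglongrightarrow> 0"
        using null by (simp add: weakly_null_def)
      show "\<forall>\<^sub>F n in sequentially. norm (Lp_norm p (g n) * \<bar>blinfun_apply \<phi> (x n)\<bar>)
          \<le> norm (blinfun_apply \<phi> (x n)) * K"
        using gK by (intro always_eventually allI)
          (simp add: abs_mult Lp_norm_nonneg mult_right_mono mult.commute[of _ K])
    qed
    ultimately show "(\<lambda>n. Lp_norm p (\<lambda>\<omega>. blinfun_apply \<phi> (f n \<omega>) - blinfun_apply \<phi> 0)) \<longlonglongrightarrow> 0"
      by simp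
  qed
  ultimately obtain r h where r: "strict_mono (r :: nat \<Rightarrow> nat)"
    and h: "tendsto_scalarly_ae (\<lambda>k. f (r k)) h"
    using E unfolding property_E_def by blast

  \<comment> \<open>The functional found below vanishes on \<open>x (r k)\<close> for odd \<open>k\<close>; this forces the scalar limit to be
    \<open>0\<close> without comparing \<open>h\<close> to the limit in \<open>L\<^sub>p\<close>.\<close>
  define \<rho> where "\<rho> k = r (2 * k)" for k
  have \<rho>: "strict_mono \<rho>"
    using r by (auto simp: \<rho>_def strict_mono_def)
  \<comment> \<open>\<open>e k\<close> is the integer part of the binary logarithm of
    \<open>k + 1\<close>, so a block of length \<open>e k\<close> has measure between
    \<open>1 / (k + 1)\<close> and \<open>2 / (k + 1)\<close>: the lower bound feeds Borel-Cantelli,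
    the upper one summability.\<close>
  have "\<exists>e. 2 ^ e \<le> Suc k \<and> Suc k < 2 ^ (e + 1)" for k
    by (rule ex_power_ivl1) auto
  then obtain e where e: "\<And>k. 2 ^ e k \<le> Suc k" "\<And>k. Suc k < 2 ^ (e k + 1)"
    by metis
  \<comment> \<open>\<open>heavy_tail p s (\<rho> k)\<close> sees only blocks of length at most
    \<open>\<rho> k\<close>.\<close>
  have "e k \<le> k" for k
    using e(1)[of k] less_exp[of "e k"] by linarith
  then have e_le: "e k \<le> \<rho> k" for k
    using strict_mono_imp_increasing[OF \<rho>, of k] by (meson order_trans)

  \<comment> \<open>The value at \<open>\<rho> k\<close> is the reciprocal of the lower bound
    \<open>2 powr (e k / s)\<close> for \<open>g (\<rho> k)\<close> on a zero block of length
    \<open>e k\<close>.\<close>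
  define b where "b n = (if n \<in> range \<rho> then 2 powr - (e (inv \<rho> n) / s) else 0)" for n
  have b_\<rho>: "b (\<rho> k) = 2 powr - (e k / s)" for k
    using \<rho> by (simp add: b_def strict_mono_imp_inj_on)
  have b_odd: "b (r (2 * k + 1)) = 0" for k
    using strict_mono_eq[OF r] by (auto simp: b_def \<rho>_def) presburger
  have "summable (\<lambda>k. \<bar>b (\<rho> k)\<bar> powr q')"
  proof (rule summable_comparison_test')
    \<comment> \<open>The exponent \<open>q' / s\<close> exceeds 1; the factor
      \<open>2 powr (q' / s)\<close> absorbs the \<open>+ 1\<close> in
      \<open>Suc k < 2 ^ (e k + 1)\<close>.\<close>
    show "summable (\<lambda>k. 2 powr (q' / s) * real (Suc k) powr - (q' / s))"
      using s p by (subst summable_Suc_iff) (auto intro!: summable_mult simp: summable_real_powr_iff)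
    fix k
    have "real (Suc k) < 2 ^ (e k + 1)"
      using e(2)[of k] by (metis of_nat_less_iff of_nat_numeral of_nat_power)
    then have "real (Suc k) \<le> 2 powr (e k + 1)"
      by (simp add: powr_realpow[symmetric] powr_add)
    then have "(2 powr (e k + 1)) powr - (q' / s) \<le> real (Suc k) powr - (q' / s)"
      using s p by (intro powr_mono2') auto
    then have "2 powr (q' / s) * 2 powr - ((e k + 1) * q' / s) \<le> 2 powr (q' / s) * real (Suc k) powr - (q' / s)"
      by (intro mult_left_mono) (auto simp: powr_powr)
    moreover have "\<bar>b (\<rho> k)\<bar> powr q' = 2 powr (q' / s) * 2 powr - ((e k + 1) * q' / s)"
      by (simp add: b_\<rho> powr_powr add_divide_distrib algebra_simps flip: powr_add)
    ultimately show "norm (\<bar>b (\<rho> k)\<bar> powr q') \<le> 2 powr (q' / s) * real (Suc k) powr - (q' / s)"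
      by simp
  qed
  then have "summable (\<lambda>n. \<bar>b n\<bar> powr q')"
    using \<rho> by (subst (asm) summable_mono_reindex) (auto simp: b_def)
  then obtain \<phi> :: "'a \<Rightarrow>\<^sub>L real" where \<phi>: "\<And>n. blinfun_apply \<phi> (x n) = b n"
    using lower_estimate_imp_functional[OF q lower \<open>\<delta> > 0\<close> \<delta>] by blast
  have \<phi>f: "blinfun_apply \<phi> (f n \<omega>) = g n \<omega> * b n" for n \<omega>
    by (simp add: f_def blinfun.scaleR_right \<phi>)

  have "AE \<omega> in lebesgue. \<omega> \<in> {0..<1} \<longrightarrow> (\<forall>m. \<exists>k\<ge>m. \<omega> \<in> zero_block ((\<rho> k)\<^sup>2) (e k))"
  proof (rule AE_infinitely_many_zero_blocks[OF _ e(1)])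
    fix k
    \<comment> \<open>Consecutive squares differ by \<open>2 * \<rho> k + 1\<close>, which leaves
      room for \<open>e k\<close> digits.\<close>
    have "(\<rho> k)\<^sup>2 + e k \<le> (Suc (\<rho> k))\<^sup>2"
      using e_le[of k] by (simp add: power2_eq_square)
    also have "\<dots> \<le> (\<rho> (Suc k))\<^sup>2"
      using \<rho> by (intro power_mono) (auto simp: strict_mono_Suc_iff Suc_le_eq)
    finally show "(\<rho> k)\<^sup>2 + e k \<le> (\<rho> (Suc k))\<^sup>2" .
  qed
  moreover have "AE \<omega> in lebesgue. \<omega> \<in> {0..1} \<longrightarrow>
      (\<lambda>k. blinfun_apply \<phi> (f (r k) \<omega>)) \<longlonglongrightarrow> blinfun_apply \<phi> (h \<omega>)"
    using h unfolding tendsto_scalarly_ae_def by (simp add: AE_restrict_space_iff)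
  ultimately have "AE \<omega> in lebesgue. \<omega> \<notin> {0..<1 :: real}"
  proof eventually_elim
    fix \<omega> :: real
    assume io: "\<omega> \<in> {0..<1} \<longrightarrow> (\<forall>m. \<exists>k\<ge>m. \<omega> \<in> zero_block ((\<rho> k)\<^sup>2) (e k))"
      and lim: "\<omega> \<in> {0..1} \<longrightarrow> (\<lambda>k. blinfun_apply \<phi> (f (r k) \<omega>)) \<longlonglongrightarrow> blinfun_apply \<phi> (h \<omega>)"
    show "\<omega> \<notin> {0..<1}"
    proof
      assume \<omega>: "\<omega> \<in> {0..<1}"
      then have lim: "(\<lambda>k. blinfun_apply \<phi> (f (r k) \<omega>)) \<longlonglongrightarrow> blinfun_apply \<phi> (h \<omega>)"
        using lim by simp
      \<comment> \<open>Odd indices identify the limit as 0; even indices, where the product is at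
        least 1 infinitely often, contradict it.\<close>
      have "strict_mono (\<lambda>k::nat. 2 * k + 1)" "strict_mono (\<lambda>k::nat. 2 * k)"
        by (auto simp: strict_mono_def)
      note subseq = LIMSEQ_subseq_LIMSEQ[OF lim this(1)] LIMSEQ_subseq_LIMSEQ[OF lim this(2)]
      have "blinfun_apply \<phi> (h \<omega>) = 0"
        using subseq(1) b_odd by (simp add: o_def \<phi>f LIMSEQ_const_iff)
      then have "(\<lambda>k. g (\<rho> k) \<omega> * b (\<rho> k)) \<longlonglongrightarrow> 0"
        using subseq(2) by (simp add: o_def \<phi>f \<rho>_def)
      then have "\<forall>\<^sub>F k in sequentially. g (\<rho> k) \<omega> * b (\<rho> k) < 1"
        by (rule order_tendstoD) simp
      then obtain m where m: "\<And>k. k \<ge> m \<Longrightarrow> g (\<rho> k) \<omega> * b (\<rho> k) < 1"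
        by (auto simp: eventually_sequentially)
      obtain k where k: "k \<ge> m" "\<omega> \<in> zero_block ((\<rho> k)\<^sup>2) (e k)"
        using io \<omega> by blast
      have "1 = 2 powr (e k / s) * b (\<rho> k)"
        by (simp add: b_\<rho> flip: powr_add)
      also have "\<dots> \<le> g (\<rho> k) \<omega> * b (\<rho> k)"
        unfolding g_def using p e_le \<omega> k(2) by (intro mult_right_mono heavy_tail_ge) (auto simp: b_\<rho>)
      finally show False
        using m[OF k(1)] by simp
    qed
  qed
  then have "{0..<1::real} \<in> null_sets lebesgue"
    by (subst AE_iff_null_sets) auto
  then have "emeasure lborel {0..<1::real} = 0"
    by (simp add: null_sets_def)
  then show False
    by simp
qed

theorem theorem4p6:
  fixes x :: "nat \<Rightarrow> 'a::banach" and q q' :: ereal and p :: real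
  assumes "1 < q" and "q \<le> \<infinity>" and "1 / q + 1 / q' = 1"
    and "weakly_null x" and "semi_normalized x" and "basic_sequence x"
    and "lower_estimate q x"
    and "1 \<le> p" and "ereal p < q'"
  shows "\<not> property_E TYPE('a) p"
proof -
  have "q' > 1"
    using assms(8,9) by (metis ereal_less_eq(3) one_ereal_def order_le_less_trans)
  have "q \<noteq> \<infinity>"
  proof
    assume "q = \<infinity>"
    then have "1 / q' = 1"
      using assms(3) by simp
    then show False
      using \<open>q' > 1\<close> by (cases q') (auto simp: one_ereal_def)
  qed
  then obtain Q where Q: "q = ereal Q" "Q > 1"
    using \<open>1 < q\<close> by (cases q) auto
  \<comment> \<open>As \<open>1 / \<infinity> = 0\<close> in \<open>ereal\<close>, an infinite
    \<open>q'\<close> would force \<open>q = 1\<close>.\<close>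
  have "q' \<noteq> \<infinity>"
    using assms(3) Q by (auto simp: one_ereal_def)
  then obtain Q' where Q': "q' = ereal Q'" "Q' > 1"
    using \<open>q' > 1\<close> by (cases q') auto
  have "1 / Q + 1 / Q' = 1"
    using assms(3) Q Q' by (simp add: one_ereal_def)
  then show ?thesis
    using not_property_E[of Q Q' p x] assms Q Q' by simp
qed

end
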